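(* Fix $p\in[2,\infty)$ and $t\in\mathbb N$. Let $X$ be a normed space with $K_p(X)<\infty$. Then for every $n\times n$ symmetric stochastic matrix $A=(a_{ij})$ we have $$\gamma_+\left(A^t,\|\cdot\|_X^p\right)\le\left[4K_p(X)\right]^{p^2}\cdot\max\left\{1,\left(\frac{\gamma_+\left(A,\|\cdot\|_X^p\right)}{t}\right)^p\right\}.$$
   Context: $K_p(X)$ (the $p$-convexity constant of the normed space $X$) is the infimum over those $K\in[1,\infty)$ such that for every $x,y\in X$, $$\|x\|_X^p+\frac1{K^p}\|y\|_X^p\le\frac{\|x+y\|_X^p+\|x-y\|_X^p}2$$ ($\infty$ if no such $K$ exists). For a symmetric $K:X\times X\to[0,\infty)$ and an $n\times n$ symmetric stochastic matrix $A=(a_{ij})$, $\gamma_+(A,K)\in[0,\infty]$ is the infimum over those $\gamma_+>0$ such that for all $x_1,\ldots,x_n,y_1,\ldots,y_n\in X$, $$\frac1{n^2}\sum_{i,j=1}^nK(x_i,y_j)\le\frac{\gamma_+}{n}\sum_{i,j=1}^na_{ij}K(x_i,y_j)$$ ($\infty$ if there is no finite such $\gamma_+$). The notation $\|\cdot\|_X^p$ stands for the kernel $K(x,y)=\|x-y\|_X^p$. *)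

theory Defs
  imports "HOL-Analysis.Analysis"
begin

definition ennpowr :: "ennreal \<Rightarrow> real \<Rightarrow> ennreal" where
  \<comment> \<open>The real power on $[0,\infty]$, intended for exponents \<open>a > 0\<close> only,
      for which $0^a = 0$ and $\infty^a = \infty$.\<close>
  "ennpowr x a = (if x = top then top else ennreal (enn2real x powr a))"

definition convexity_const :: "'a::real_normed_vector itself \<Rightarrow> real \<Rightarrow> ennreal" where
  \<comment> \<open>\<open>Inf {} = top\<close> in \<^typ>\<open>ennreal\<close>, which is the convention
      for the case that no admissible constant exists.\<close>
  "convexity_const _ p = Inf (ennreal ` {K. 1 \<le> K \<and>
     (\<forall>x y :: 'a. norm x powr p + 1 / K powr p * norm y powr p
        \<le> (norm (x + y) powr p + norm (x - y) powr p) / 2)})"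

definition symmetric_stochastic :: "real ^ 'n ^ 'n \<Rightarrow> bool" where
  "symmetric_stochastic A \<longleftrightarrow>
     transpose A = A \<and> (\<forall>i j. 0 \<le> A $ i $ j) \<and> (\<forall>i. (\<Sum>j\<in>UNIV. A $ i $ j) = 1)"

primrec matrix_power :: "real ^ 'n ^ 'n \<Rightarrow> nat \<Rightarrow> real ^ 'n ^ 'n" where
  "matrix_power A 0 = mat 1"
| "matrix_power A (Suc t) = A ** matrix_power A t"

definition gamma_plus :: "real ^ 'n ^ 'n \<Rightarrow> ('a \<Rightarrow> 'a \<Rightarrow> real) \<Rightarrow> ennreal" where
  \<comment> \<open>Meant for symmetric nonnegative kernels \<open>K\<close>; again \<open>Inf {} = top\<close>.\<close>
  "gamma_plus A K = Inf (ennreal ` {g. 0 < g \<and>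
     (\<forall>x y :: 'n \<Rightarrow> 'a.
        1 / (real CARD('n))\<^sup>2 * (\<Sum>i\<in>UNIV. \<Sum>j\<in>UNIV. K (x i) (y j))
        \<le> g / real CARD('n) * (\<Sum>i\<in>UNIV. \<Sum>j\<in>UNIV. A $ i $ j * K (x i) (y j)))})"

definition norm_kernel :: "real \<Rightarrow> 'a::real_normed_vector \<Rightarrow> 'a \<Rightarrow> real" where
  "norm_kernel p x y = norm (x - y) powr p"

end

theory Submission
  imports Defs
begin

text \<open>
  Iterating $p$-convexity at the midpoint of a random vector and its mean gives
  $\|EU\|^p + c K^{-p} E\|U - EU\|^p \le E\|U\|^p$ with $c = 1/(2^{p-1}-1)$.
  Applied to the rows of $A$, and combined with the Poincare inequality for the pair $(Af, f)$,
  it shows that $A$ contracts $\|f\|_p^p$ by the factor $e^{-\varepsilon}$,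
  $\varepsilon = c/(K^p \gamma)$, on mean-zero functions $f$; hence $A^t$ contracts $\|f\|_p$ by
  $\lambda = e^{-\varepsilon t/p}$.
  Conversely, if $B$ contracts mean-zero functions by $\lambda < 1$, then
  $\|f\|_p \le \|f - Bg\|_p + \lambda \|g\|_p$ and its mirror image bound both norms by the
  edge energy of $B$, which gives $\gamma_+(B) \le (1 + 4/(1-\lambda))^p$.
  It remains to check $1 + 4/(1-\lambda) \le (4K)^p \max\{1, \gamma/t\}$.
\<close>

section \<open>Jensen and Minkowski inequalities for powers of norms\<close>

text \<open>For positive arguments this is \<open>powr_convex\<close>. If one argument is 0,
  convexity reduces to s^p \<le> s for 0 < s < 1.\<close>

lemma convex_on_powr_nonneg:
  assumes "1 \<le> p" shows "convex_on {0..} (\<lambda>x::real. x powr p)"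
proof (rule convex_onI)
  fix t x y :: real
  assume t: "0 < t" "t < 1" and xy: "x \<in> {0..}" "y \<in> {0..}"
  have le: "(s * z) powr p \<le> s * z powr p" if "0 < s" "s < 1" "0 \<le> z" for s z :: real
  proof -
    have "s powr p \<le> s powr 1"
      using that assms by (intro powr_mono') auto
    then show ?thesis
      using that by (simp add: powr_mult mult_right_mono)
  qed
  consider "x = 0" | "y = 0" | "0 < x" "0 < y" using xy by force
  then show "((1 - t) *\<^sub>R x + t *\<^sub>R y) powr p \<le> (1 - t) * x powr p + t * y powr p"
  proof cases
    case 3
    then show ?thesis
      using convex_onD[OF powr_convex[OF assms], of t x y] t by simp
  qed (use t xy le in auto)
qed simp

lemma convex_on_norm_powr:
  assumes "1 \<le> p" shows "convex_on UNIV (\<lambda>x::'a::real_normed_vector. norm x powr p)"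
proof (rule convex_onI)
  fix t :: real and x y :: 'a
  assume t: "0 < t" "t < 1"
  have "norm ((1 - t) *\<^sub>R x + t *\<^sub>R y) \<le> (1 - t) * norm x + t * norm y"
    using t norm_triangle_ineq[of "(1 - t) *\<^sub>R x" "t *\<^sub>R y"] by simp
  then have "norm ((1 - t) *\<^sub>R x + t *\<^sub>R y) powr p \<le> ((1 - t) * norm x + t * norm y) powr p"
    using assms by (intro powr_mono2) auto
  also have "\<dots> \<le> (1 - t) * norm x powr p + t * norm y powr p"
    using convex_onD[OF convex_on_powr_nonneg[OF assms], of t "norm x" "norm y"] t by simp
  finally show "norm ((1 - t) *\<^sub>R x + t *\<^sub>R y) powr p \<le> (1 - t) * norm x powr p + t * norm y powr p" .
qed simp

lemma norm_sum_powr_le: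
  fixes f :: "'i \<Rightarrow> 'a::real_normed_vector"
  assumes "finite I" "1 \<le> p" "sum w I = 1" "\<And>i. i \<in> I \<Longrightarrow> 0 \<le> w i"
  shows "norm (\<Sum>i\<in>I. w i *\<^sub>R f i) powr p \<le> (\<Sum>i\<in>I. w i * norm (f i) powr p)"
  using convex_on_sum[OF _ _ convex_on_norm_powr[OF assms(2)], of I w f] assms by fastforce

text \<open>Weighted l^p norm of a vector-valued family. Unit weights give the norm of a function on
  the index set of a matrix; the entries of a stochastic matrix, as weights on pairs of indices,
  give its edge energy.\<close>

definition wlp_norm :: "real \<Rightarrow> ('i \<Rightarrow> real) \<Rightarrow> 'i set \<Rightarrow> ('i \<Rightarrow> 'a::real_normed_vector) \<Rightarrow> real" where
  "wlp_norm p w I f = (\<Sum>i\<in>I. w i * norm (f i) powr p) powr (1 / p)"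

lemma wlp_norm_nonneg [simp]: "0 \<le> wlp_norm p w I f"
  by (simp add: wlp_norm_def)

lemma wlp_norm_powr:
  assumes "1 \<le> p" "\<And>i. i \<in> I \<Longrightarrow> 0 \<le> w i"
  shows "wlp_norm p w I f powr p = (\<Sum>i\<in>I. w i * norm (f i) powr p)"
  using assms by (simp add: wlp_norm_def powr_powr sum_nonneg)

text \<open>Minkowski from convexity: if f/a and g/b lie in the unit ball, so does (f + g)/(a + b),
  being their convex combination with coefficients a/(a + b) and b/(a + b).\<close>

lemma wlp_norm_triangle:
  fixes f g :: "'i \<Rightarrow> 'a::real_normed_vector"
  assumes I: "finite I" and p: "1 \<le> p" and w: "\<And>i. i \<in> I \<Longrightarrow> 0 \<le> w i"
  shows "wlp_norm p w I (\<lambda>i. f i + g i) \<le> wlp_norm p w I f + wlp_norm p w I g"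
proof (rule field_le_epsilon)
  fix e :: real assume e: "0 < e"
  \<comment> \<open>The extra e/2 keeps both divisors positive even when a norm vanishes.\<close>
  define a b where "a = wlp_norm p w I f + e / 2" and "b = wlp_norm p w I g + e / 2"
  have ab: "0 < a" "0 < b"
    unfolding a_def b_def using e by (auto intro: add_nonneg_pos)
  have scale: "(\<Sum>i\<in>I. w i * norm (h i /\<^sub>R c) powr p) = (\<Sum>i\<in>I. w i * norm (h i) powr p) / c powr p"
    if "0 < c" for h :: "'i \<Rightarrow> 'a" and c
    using that by (simp add: powr_mult inverse_powr sum_distrib_left divide_inverse mult_ac)
  have unit: "(\<Sum>i\<in>I. w i * norm (h i /\<^sub>R c) powr p) \<le> 1"
    if c: "0 < c" "wlp_norm p w I h \<le> c" for h :: "'i \<Rightarrow> 'a" and c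
  proof -
    have "(\<Sum>i\<in>I. w i * norm (h i /\<^sub>R c) powr p) = wlp_norm p w I h powr p / c powr p"
      using c by (simp add: wlp_norm_powr[OF p w] scale del: norm_scaleR)
    also have "\<dots> \<le> 1"
      using c p by (simp add: powr_mono2)
    finally show ?thesis .
  qed
  have "(\<Sum>i\<in>I. w i * norm ((f i + g i) /\<^sub>R (a + b)) powr p)
      \<le> (\<Sum>i\<in>I. w i * (a / (a + b) * norm (f i /\<^sub>R a) powr p + b / (a + b) * norm (g i /\<^sub>R b) powr p))"
  proof (intro sum_mono mult_left_mono w)
    fix i
    have s: "1 - b / (a + b) = a / (a + b)"
      using ab by (simp add: field_simps)
    have "(f i + g i) /\<^sub>R (a + b) = (a / (a + b)) *\<^sub>R (f i /\<^sub>R a) + (b / (a + b)) *\<^sub>R (g i /\<^sub>R b)"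
      using ab by (simp add: scaleR_add_right field_simps)
    then show "norm ((f i + g i) /\<^sub>R (a + b)) powr p
        \<le> a / (a + b) * norm (f i /\<^sub>R a) powr p + b / (a + b) * norm (g i /\<^sub>R b) powr p"
      using convex_onD[OF convex_on_norm_powr[OF p], of "b / (a + b)" "f i /\<^sub>R a" "g i /\<^sub>R b"] ab s
      by (simp del: norm_scaleR scaleR_scaleR)
  qed
  also have "\<dots> = a / (a + b) * (\<Sum>i\<in>I. w i * norm (f i /\<^sub>R a) powr p)
      + b / (a + b) * (\<Sum>i\<in>I. w i * norm (g i /\<^sub>R b) powr p)"
    by (simp only: distrib_left sum.distrib sum_distrib_left mult_ac)
  also have "\<dots> \<le> a / (a + b) * 1 + b / (a + b) * 1"
    using ab e by (intro add_mono mult_left_mono unit) (auto simp: a_def b_def)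
  also have "\<dots> = 1" using ab by (simp flip: add_divide_distrib)
  finally have "(\<Sum>i\<in>I. w i * norm ((f i + g i) /\<^sub>R (a + b)) powr p) \<le> 1" .
  moreover have "(\<Sum>i\<in>I. w i * norm ((f i + g i) /\<^sub>R (a + b)) powr p)
      = (\<Sum>i\<in>I. w i * norm (f i + g i) powr p) / (a + b) powr p"
    using ab by (intro scale) simp
  ultimately have "wlp_norm p w I (\<lambda>i. f i + g i) powr p \<le> (a + b) powr p"
    using ab by (simp add: wlp_norm_powr[OF p w])
  then have "wlp_norm p w I (\<lambda>i. f i + g i) \<le> a + b"
    using ab p powr_less_mono2[of p "a + b" "wlp_norm p w I (\<lambda>i. f i + g i)"] by linarith
  then show "wlp_norm p w I (\<lambda>i. f i + g i) \<le> wlp_norm p w I f + wlp_norm p w I g + e"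
    by (simp add: a_def b_def)
qed

section \<open>Uniform convexity of the variance\<close>

text \<open>Jensen gives the constant 0, and each improvement maps \<theta> to r(\<theta> + L) with
  r = 2^(1-p) < 1 and L = K^(-p). The fixed point rL/(1 - r) of this contraction is the constant
  claimed.\<close>

lemma p_convex_variance:
  fixes u :: "'i \<Rightarrow> 'a::real_normed_vector"
  assumes pc: "\<And>x y::'a. norm x powr p + 1 / K powr p * norm y powr p
      \<le> (norm (x + y) powr p + norm (x - y) powr p) / 2"
    and p: "1 < p" and I: "finite I" and w: "sum w I = 1" "\<And>i. i \<in> I \<Longrightarrow> 0 \<le> w i"
  shows "norm (\<Sum>i\<in>I. w i *\<^sub>R u i) powr p
      + 1 / ((2 powr (p - 1) - 1) * K powr p) * (\<Sum>i\<in>I. w i * norm (u i - (\<Sum>i\<in>I. w i *\<^sub>R u i)) powr p)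
      \<le> (\<Sum>i\<in>I. w i * norm (u i) powr p)"
proof -
  define m where "m u = (\<Sum>i\<in>I. w i *\<^sub>R u i)" for u :: "'i \<Rightarrow> 'a"
  define S where "S u = (\<Sum>i\<in>I. w i * norm (u i - m u) powr p)" for u :: "'i \<Rightarrow> 'a"
  define T where "T u = (\<Sum>i\<in>I. w i * norm (u i) powr p)" for u :: "'i \<Rightarrow> 'a"
  define L where "L = 1 / K powr p"
  define h :: real where "h = (1 / 2) powr p"
  define r where "r = 2 * h"
  have half: "norm ((1 / 2 :: real) *\<^sub>R z) powr p = h * norm z powr p" for z :: 'a
    by (simp add: h_def powr_mult powr_divide)
  \<comment> \<open>Any admissible constant \<open>\<theta>\<close> improves to \<open>r * (\<theta> + L)\<close>:
      use it for the midpoint of \<open>u\<close> and its mean.\<close>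
  have step: "norm (m u) powr p + r * (\<theta> + L) * S u \<le> T u"
    if \<theta>: "\<And>v. norm (m v) powr p + \<theta> * S v \<le> T v" for \<theta> u
  proof -
    define v where "v i = (1 / 2 :: real) *\<^sub>R (u i + m u)" for i
    have mv: "m v = m u"
    proof -
      have "m v = (1 / 2 :: real) *\<^sub>R (m u + (\<Sum>i\<in>I. w i *\<^sub>R m u))"
        by (simp add: m_def v_def scaleR_sum_right scaleR_add_right sum.distrib mult.commute)
      also have "(\<Sum>i\<in>I. w i *\<^sub>R m u) = m u"
        using w by (simp flip: scaleR_sum_left)
      finally show ?thesis by (simp only: scaleR_half_double)
    qed
    have vm: "v i - m u = (1 / 2 :: real) *\<^sub>R (u i - m u)" for i
    proof -
      have "v i - m u = (1 / 2 :: real) *\<^sub>R (u i + m u) - (1 / 2 :: real) *\<^sub>R (m u + m u)"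
        by (simp only: v_def scaleR_half_double)
      also have "\<dots> = (1 / 2 :: real) *\<^sub>R (u i - m u)"
        unfolding scaleR_diff_right[symmetric] by simp
      finally show ?thesis .
    qed
    have Sv: "S v = h * S u"
      by (simp add: S_def mv vm half sum_distrib_left mult_ac del: norm_scaleR)
    \<comment> \<open>p-convexity is used with x = v i and y = (u i - m u)/2, so that x + y = u i
      and x - y = m u.\<close>
    have "T v + L * h * S u = (\<Sum>i\<in>I. w i * (norm (v i) powr p + L * norm ((1 / 2 :: real) *\<^sub>R (u i - m u)) powr p))"
      by (simp add: T_def S_def half distrib_left sum.distrib sum_distrib_left mult_ac del: norm_scaleR)
    also have "\<dots> \<le> (\<Sum>i\<in>I. w i * ((norm (u i) powr p + norm (m u) powr p) / 2))"
    proof (intro sum_mono mult_left_mono w)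
      fix i
      have "v i + (1 / 2 :: real) *\<^sub>R (u i - m u) = u i" "v i - (1 / 2 :: real) *\<^sub>R (u i - m u) = m u"
        by (simp_all add: v_def scaleR_half_double flip: scaleR_add_right scaleR_diff_right)
      then show "norm (v i) powr p + L * norm ((1 / 2 :: real) *\<^sub>R (u i - m u)) powr p
          \<le> (norm (u i) powr p + norm (m u) powr p) / 2"
        using pc[of "v i" "(1 / 2 :: real) *\<^sub>R (u i - m u)"] by (simp add: L_def del: norm_scaleR)
    qed
    also have "\<dots> = (T u + norm (m u) powr p) / 2"
      using w by (simp add: T_def distrib_left sum.distrib add_divide_distrib
          flip: sum_divide_distrib sum_distrib_right)
    \<comment> \<open>Inserting the assumption on \<theta> for v, with \<open>m v = m u\<close> and
      \<open>S v = h * S u\<close>, and doubling turns h(\<theta> + L) into r(\<theta> + L).\<close>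
    finally show ?thesis
      using \<theta>[of v] by (simp add: mv Sv r_def algebra_simps)
  qed
  have r: "0 < r" "r < 1"
  proof -
    have "h < (1 / 2) powr 1" unfolding h_def using p by (intro powr_less_mono') auto
    then show "0 < r" "r < 1" by (auto simp: r_def h_def)
  qed
  \<comment> \<open>The coefficient of S u is the n-th iterate of \<theta> \<mapsto> r(\<theta> + L)
    started at 0.\<close>
  have iter: "norm (m u) powr p + r * L / (1 - r) * (1 - r ^ n) * S u \<le> T u" for n u
  proof (induction n arbitrary: u)
    case 0
    then show ?case
      using norm_sum_powr_le[OF I less_imp_le[OF p] w, of u] by (simp add: m_def T_def)
  next
    case (Suc n)
    have "r * L / (1 - r) * (1 - r ^ Suc n) = r * (r * L / (1 - r) * (1 - r ^ n) + L)"
      using r by (simp add: field_simps)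
    then show ?case using step[OF Suc] by metis
  qed
  have "(\<lambda>n. norm (m u) powr p + r * L / (1 - r) * (1 - r ^ n) * S u)
      \<longlonglongrightarrow> norm (m u) powr p + r * L / (1 - r) * (1 - 0) * S u"
    using r by (intro tendsto_intros LIMSEQ_realpow_zero) auto
  then have "norm (m u) powr p + r * L / (1 - r) * (1 - 0) * S u \<le> T u"
    by (rule LIMSEQ_le_const2) (use iter in blast)
  moreover have "r * L / (1 - r) = 1 / ((2 powr (p - 1) - 1) * K powr p)"
  proof -
    have "2 powr (p - 1) - 1 = (1 - r) / r"
      using r by (simp add: r_def h_def powr_diff powr_divide field_simps)
    then show ?thesis by (simp add: L_def)
  qed
  ultimately show ?thesis by (simp add: m_def S_def T_def)
qed

section \<open>Averaging operators\<close>

lemma symmetric_stochasticD: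
  assumes "symmetric_stochastic A"
  shows "0 \<le> A $ i $ j" "A $ i $ j = A $ j $ i" "(\<Sum>j\<in>UNIV. A $ i $ j) = 1" "(\<Sum>i\<in>UNIV. A $ i $ j) = 1"
proof -
  have sym: "A $ i $ j = A $ j $ i" for i j
  proof -
    have "transpose A $ j $ i = A $ j $ i"
      using assms by (simp add: symmetric_stochastic_def)
    then show ?thesis by (simp add: transpose_def)
  qed
  have row: "(\<Sum>j\<in>UNIV. A $ i $ j) = 1" for i
    using assms by (simp add: symmetric_stochastic_def)
  have "(\<Sum>i\<in>UNIV. A $ i $ j) = (\<Sum>i\<in>UNIV. A $ j $ i)"
    by (intro sum.cong refl sym)
  then show "(\<Sum>i\<in>UNIV. A $ i $ j) = 1" by (simp add: row)
  show "(\<Sum>j\<in>UNIV. A $ i $ j) = 1" by (rule row)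
  show "A $ i $ j = A $ j $ i" by (rule sym)
  show "0 \<le> A $ i $ j"
    using assms by (simp add: symmetric_stochastic_def)
qed

text \<open>The operator A \<otimes> Id on vector-valued functions.\<close>

definition mat_act :: "real ^ 'n ^ 'n \<Rightarrow> ('n \<Rightarrow> 'a::real_normed_vector) \<Rightarrow> 'n \<Rightarrow> 'a" where
  "mat_act A f i = (\<Sum>j\<in>UNIV. A $ i $ j *\<^sub>R f j)"

lemma mat_act_mat_1 [simp]: "mat_act (mat 1) f = f"
proof
  fix i
  have "mat_act (mat 1) f i = (\<Sum>j\<in>UNIV. if i = j then f j else 0)"
    unfolding mat_act_def mat_def by (intro sum.cong) auto
  then show "mat_act (mat 1) f i = f i" by simp
qed

lemma mat_act_mult: "mat_act (A ** B) f = mat_act A (mat_act B f)"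
proof
  fix i
  have "mat_act (A ** B) f i = (\<Sum>j\<in>UNIV. \<Sum>k\<in>UNIV. A $ i $ k *\<^sub>R B $ k $ j *\<^sub>R f j)"
    by (simp add: mat_act_def matrix_matrix_mult_def scaleR_sum_left)
  also have "\<dots> = mat_act A (mat_act B f) i"
    by (subst sum.swap) (simp add: mat_act_def scaleR_sum_right)
  finally show "mat_act (A ** B) f i = mat_act A (mat_act B f) i" .
qed

text \<open>Since the columns sum to 1, mean-zero functions form an invariant subspace; this is what
  allows a contraction on them to be iterated.\<close>

lemma sum_mat_act:
  assumes "symmetric_stochastic A"
  shows "(\<Sum>i\<in>UNIV. mat_act A f i) = (\<Sum>i\<in>UNIV. f i)"
  unfolding mat_act_def
  by (subst sum.swap) (simp add: symmetric_stochasticD(4)[OF assms] flip: scaleR_sum_left)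

lemma symmetric_stochastic_matrix_power:
  assumes A: "symmetric_stochastic A"
  shows "symmetric_stochastic (matrix_power A t)"
proof -
  \<comment> \<open>A product of symmetric matrices is symmetric when the factors commute.\<close>
  have comm: "A ** matrix_power A t = matrix_power A t ** A" for t
    by (induction t) (simp_all add: matrix_mul_assoc)
  show ?thesis
  proof (induction t)
    case 0
    then show ?case
      by (auto simp: symmetric_stochastic_def mat_def transpose_mat[unfolded mat_def])
  next
    case (Suc t)
    let ?B = "matrix_power A t"
    have "transpose (A ** ?B) = A ** ?B"
      using A Suc by (metis comm matrix_transpose_mul symmetric_stochastic_def)
    moreover have "0 \<le> (A ** ?B) $ i $ j" for i j
      by (auto simp: matrix_matrix_mult_def intro!: sum_nonneg mult_nonneg_nonneg
          symmetric_stochasticD(1)[OF A] symmetric_stochasticD(1)[OF Suc])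
    moreover have "(\<Sum>j\<in>UNIV. (A ** ?B) $ i $ j) = 1" for i
    proof -
      have "(\<Sum>j\<in>UNIV. (A ** ?B) $ i $ j) = (\<Sum>k\<in>UNIV. A $ i $ k * (\<Sum>j\<in>UNIV. ?B $ k $ j))"
        unfolding matrix_matrix_mult_def sum_distrib_left by (simp, subst sum.swap, simp)
      then show ?thesis
        by (simp add: symmetric_stochasticD(3)[OF A] symmetric_stochasticD(3)[OF Suc])
    qed
    ultimately show ?case by (simp add: symmetric_stochastic_def)
  qed
qed


section \<open>Poincare inequalities and contraction on mean-zero functions\<close>

text \<open>The condition in the set defining \<open>gamma_plus\<close>, separated from 0 < g
  because the infimum itself may be 0.\<close>

definition poincare_ineq :: "real ^ 'n ^ 'n \<Rightarrow> ('a \<Rightarrow> 'a \<Rightarrow> real) \<Rightarrow> real \<Rightarrow> bool" where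
  "poincare_ineq A K g \<longleftrightarrow> (\<forall>x y :: 'n \<Rightarrow> 'a.
     1 / (real CARD('n))\<^sup>2 * (\<Sum>i\<in>UNIV. \<Sum>j\<in>UNIV. K (x i) (y j))
     \<le> g / real CARD('n) * (\<Sum>i\<in>UNIV. \<Sum>j\<in>UNIV. A $ i $ j * K (x i) (y j)))"

text \<open>Row i of A is the law of a random value f j with mean (Af) i, so the edge energy W of
  the pair (Af, f) is exactly the total of the variance terms in \<open>p_convex_variance\<close>.
  The Poincare inequality bounds W from below by F/g.\<close>

lemma mat_act_contraction:
  fixes f :: "'n::finite \<Rightarrow> 'a::real_normed_vector"
  assumes pc: "\<And>x y::'a. norm x powr p + 1 / K powr p * norm y powr p
      \<le> (norm (x + y) powr p + norm (x - y) powr p) / 2"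
    and p: "1 < p" and K: "0 < K" and A: "symmetric_stochastic (A :: real ^ 'n ^ 'n)"
    and g: "0 < g" "poincare_ineq A (norm_kernel p :: 'a \<Rightarrow> 'a \<Rightarrow> real) g"
    and f: "(\<Sum>i\<in>UNIV. f i) = 0"
  shows "(\<Sum>i\<in>UNIV. norm (mat_act A f i) powr p)
      \<le> exp (- 1 / ((2 powr (p - 1) - 1) * K powr p * g)) * (\<Sum>i\<in>UNIV. norm (f i) powr p)"
proof -
  define D where "D = (2 powr (p - 1) - 1) * K powr p"
  define F where "F = (\<Sum>i\<in>UNIV. norm (f i) powr p)"
  define W where "W = (\<Sum>i\<in>UNIV. \<Sum>j\<in>UNIV. A $ i $ j * norm (mat_act A f i - f j) powr p)"
  define n where "n = real CARD('n)"
  have n: "0 < n" by (simp add: n_def)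
  have "2 powr 0 < (2 :: real) powr (p - 1)" using p by (intro powr_less_mono) auto
  then have D: "0 < D" using K by (simp add: D_def)
  \<comment> \<open>Af has mean zero, so - f j is the average over i of (Af) i - f j, and Jensen
    bounds F by an average over all pairs.\<close>
  have "F = (\<Sum>j\<in>UNIV. norm (\<Sum>i\<in>UNIV. (1 / n) *\<^sub>R (mat_act A f i - f j)) powr p)"
    unfolding F_def
  proof (intro sum.cong refl)
    fix j
    have "(\<Sum>i\<in>UNIV. (1 / n) *\<^sub>R (mat_act A f i - f j)) = (1 / n) *\<^sub>R (- (n *\<^sub>R f j))"
      unfolding scaleR_sum_right[symmetric] sum_subtractf sum_mat_act[OF A] f
      by (simp add: n_def sum_constant_scaleR)
    also have "\<dots> = - f j" using n by simp
    finally show "norm (f j) powr p = norm (\<Sum>i\<in>UNIV. (1 / n) *\<^sub>R (mat_act A f i - f j)) powr p"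
      by simp
  qed
  also have "\<dots> \<le> (\<Sum>j\<in>UNIV. \<Sum>i\<in>UNIV. 1 / n * norm (mat_act A f i - f j) powr p)"
    using p n by (intro sum_mono norm_sum_powr_le) (auto simp: n_def)
  also have "\<dots> = n * (1 / n\<^sup>2 * (\<Sum>i\<in>UNIV. \<Sum>j\<in>UNIV. norm_kernel p (mat_act A f i) (f j)))"
    unfolding norm_kernel_def using n
    by (subst sum.swap) (simp add: power2_eq_square flip: sum_divide_distrib)
  also have "\<dots> \<le> n * (g / n * (\<Sum>i\<in>UNIV. \<Sum>j\<in>UNIV. A $ i $ j * norm_kernel p (mat_act A f i) (f j)))"
    using g(2) n unfolding poincare_ineq_def n_def by (intro mult_left_mono) auto
  also have "\<dots> = g * W" using n by (simp add: W_def norm_kernel_def)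
  finally have F: "F \<le> g * W" .
  have "(\<Sum>i\<in>UNIV. norm (mat_act A f i) powr p) + 1 / D * W
      = (\<Sum>i\<in>UNIV. norm (mat_act A f i) powr p
          + 1 / D * (\<Sum>j\<in>UNIV. A $ i $ j * norm (f j - mat_act A f i) powr p))"
    by (simp only: sum.distrib W_def sum_distrib_left norm_minus_commute)
  also have "\<dots> \<le> (\<Sum>i\<in>UNIV. \<Sum>j\<in>UNIV. A $ i $ j * norm (f j) powr p)"
    unfolding mat_act_def D_def
    by (intro sum_mono p_convex_variance[OF pc p]) (auto simp: symmetric_stochasticD[OF A])
  also have "\<dots> = F"
    by (subst sum.swap) (simp add: F_def symmetric_stochasticD(4)[OF A] flip: sum_distrib_right)
  finally have "(\<Sum>i\<in>UNIV. norm (mat_act A f i) powr p) \<le> F - 1 / D * W" by simp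
  also have "1 / D * W \<ge> 1 / D * (F / g)"
    using F g D by (intro mult_left_mono) (auto simp: field_simps)
  then have "F - 1 / D * W \<le> (1 + - 1 / (D * g)) * F"
    by (simp add: algebra_simps)
  \<comment> \<open>The exponential form makes iteration a multiplication of the exponent by
    t.\<close>
  also have "\<dots> \<le> exp (- 1 / (D * g)) * F"
    by (intro mult_right_mono exp_ge_add_one_self) (simp add: F_def sum_nonneg)
  finally show ?thesis by (simp add: D_def F_def)
qed

lemma mat_act_power_contraction:
  fixes f :: "'n::finite \<Rightarrow> 'a::real_normed_vector"
  assumes A: "symmetric_stochastic (A :: real ^ 'n ^ 'n)"
    and contr: "\<And>f :: 'n \<Rightarrow> 'a. (\<Sum>i\<in>UNIV. f i) = 0 \<Longrightarrow>
      (\<Sum>i\<in>UNIV. norm (mat_act A f i) powr p) \<le> exp c * (\<Sum>i\<in>UNIV. norm (f i) powr p)"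
    and p: "1 \<le> p" and f: "(\<Sum>i\<in>UNIV. f i) = 0"
  shows "wlp_norm p (\<lambda>_. 1) UNIV (mat_act (matrix_power A t) f)
      \<le> exp (c * real t / p) * wlp_norm p (\<lambda>_. 1) UNIV f"
proof -
  have "(\<Sum>i\<in>UNIV. norm (mat_act (matrix_power A t) f i) powr p)
      \<le> exp (c * real t) * (\<Sum>i\<in>UNIV. norm (f i) powr p)"
  proof (induction t)
    case (Suc t)
    have "(\<Sum>i\<in>UNIV. norm (mat_act (matrix_power A (Suc t)) f i) powr p)
        \<le> exp c * (\<Sum>i\<in>UNIV. norm (mat_act (matrix_power A t) f i) powr p)"
      using contr[of "mat_act (matrix_power A t) f"] f
      by (simp add: mat_act_mult sum_mat_act symmetric_stochastic_matrix_power A)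
    also have "\<dots> \<le> exp c * (exp (c * real t) * (\<Sum>i\<in>UNIV. norm (f i) powr p))"
      using Suc by (intro mult_left_mono) auto
    also have "\<dots> = exp (c * real (Suc t)) * (\<Sum>i\<in>UNIV. norm (f i) powr p)"
      by (simp add: ring_distribs exp_add)
    finally show ?case .
  qed simp
  then have "(\<Sum>i\<in>UNIV. norm (mat_act (matrix_power A t) f i) powr p) powr (1 / p)
      \<le> (exp (c * real t) * (\<Sum>i\<in>UNIV. norm (f i) powr p)) powr (1 / p)"
    using p by (intro powr_mono2) (auto intro: sum_nonneg)
  then show ?thesis
    by (simp add: wlp_norm_def powr_mult sum_nonneg exp_powr_real)
qed

section \<open>Edge norms, and the way back from contraction to a Poincare inequality\<close>

text \<open>Encoded as \<open>wlp_norm\<close> over ordered pairs, so that its triangle inequality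
  is an instance of Minkowski.\<close>

definition edge_norm ::
    "real \<Rightarrow> real ^ 'n ^ 'n \<Rightarrow> ('n::finite \<Rightarrow> 'n \<Rightarrow> 'a::real_normed_vector) \<Rightarrow> real" where
  "edge_norm p S h = wlp_norm p (\<lambda>e. S $ fst e $ snd e) UNIV (\<lambda>e. h (fst e) (snd e))"

lemma edge_norm_eq:
  "edge_norm p S h = (\<Sum>i\<in>UNIV. \<Sum>j\<in>UNIV. S $ i $ j * norm (h i j) powr p) powr (1 / p)"
  unfolding edge_norm_def wlp_norm_def UNIV_Times_UNIV[symmetric] sum.cartesian_product
  by (simp add: case_prod_unfold)

lemma edge_norm_triangle:
  assumes "symmetric_stochastic S" "1 \<le> p"
  shows "edge_norm p S (\<lambda>i j. h i j + k i j) \<le> edge_norm p S h + edge_norm p S k"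
  unfolding edge_norm_def using assms
  by (intro wlp_norm_triangle) (auto simp: symmetric_stochasticD)

lemma edge_norm_uminus: "edge_norm p S (\<lambda>i j. - h i j) = edge_norm p S h"
  by (simp add: edge_norm_eq)

lemma edge_norm_left:
  assumes "symmetric_stochastic S"
  shows "edge_norm p S (\<lambda>i j. f i) = wlp_norm p (\<lambda>_. 1) UNIV f"
  by (simp add: edge_norm_eq wlp_norm_def symmetric_stochasticD(3)[OF assms] flip: sum_distrib_right)

lemma edge_norm_swap:
  assumes "symmetric_stochastic S"
  shows "edge_norm p S (\<lambda>i j. h j i) = edge_norm p S h"
  unfolding edge_norm_eq
  by (subst sum.swap) (simp add: symmetric_stochasticD(2)[OF assms])

lemma edge_norm_right:
  assumes "symmetric_stochastic S"
  shows "edge_norm p S (\<lambda>i j. f j) = wlp_norm p (\<lambda>_. 1) UNIV f"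
  using edge_norm_swap[OF assms, of p "\<lambda>i j. f i"] edge_norm_left[OF assms] by metis

text \<open>f i - (Sg) i is the average of f i - g j with weights S i j, so Jensen applies in every
  row.\<close>

lemma wlp_norm_diff_mat_act_le:
  assumes S: "symmetric_stochastic S" and p: "1 \<le> p"
  shows "wlp_norm p (\<lambda>_. 1) UNIV (\<lambda>i. f i - mat_act S g i) \<le> edge_norm p S (\<lambda>i j. f i - g j)"
  unfolding edge_norm_eq wlp_norm_def
proof (intro powr_mono2)
  have "norm (f i - mat_act S g i) powr p \<le> (\<Sum>j\<in>UNIV. S $ i $ j * norm (f i - g j) powr p)" for i
  proof -
    have "f i - mat_act S g i = (\<Sum>j\<in>UNIV. S $ i $ j *\<^sub>R (f i - g j))"
      by (simp add: mat_act_def scaleR_diff_right sum_subtractf symmetric_stochasticD(3)[OF S]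
          flip: scaleR_sum_left)
    then show ?thesis
      using norm_sum_powr_le[of UNIV p "\<lambda>j. S $ i $ j" "\<lambda>j. f i - g j"] p
      by (simp add: symmetric_stochasticD[OF S])
  qed
  then show "(\<Sum>i\<in>UNIV. 1 * norm (f i - mat_act S g i) powr p)
      \<le> (\<Sum>i\<in>UNIV. \<Sum>j\<in>UNIV. S $ i $ j * norm (f i - g j) powr p)"
    by (auto intro: sum_mono)
qed (use p in \<open>auto intro: sum_nonneg\<close>)

lemma poincare_ineq_of_contraction:
  fixes B :: "real ^ 'n ^ 'n"
  assumes B: "symmetric_stochastic B" and p: "1 \<le> p" and l: "0 \<le> l" "l < 1"
    and contr: "\<And>f :: 'n \<Rightarrow> 'a::real_normed_vector. (\<Sum>i\<in>UNIV. f i) = 0 \<Longrightarrow>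
      wlp_norm p (\<lambda>_. 1) UNIV (mat_act B f) \<le> l * wlp_norm p (\<lambda>_. 1) UNIV f"
  shows "poincare_ineq B (norm_kernel p :: 'a \<Rightarrow> 'a \<Rightarrow> real) ((1 + 4 / (1 - l)) powr p)"
  unfolding poincare_ineq_def
proof (intro allI)
  fix x y :: "'n \<Rightarrow> 'a"
  define n where "n = real CARD('n)"
  have n: "0 < n" by (simp add: n_def)
  \<comment> \<open>The uniform matrix turns the average over all pairs into an edge norm, which
    then obeys the same triangle inequality as that of B.\<close>
  define U :: "real ^ 'n ^ 'n" where "U = (\<chi> i j. 1 / n)"
  have U: "symmetric_stochastic U"
    by (auto simp: symmetric_stochastic_def U_def n_def transpose_def)
  let ?N = "wlp_norm p (\<lambda>_. 1) UNIV :: ('n \<Rightarrow> 'a) \<Rightarrow> real"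
  \<comment> \<open>Contraction is available only for mean-zero functions, so x - y is split into
    the centred parts f, g and the difference of the means.\<close>
  define mx my where "mx = (1 / n) *\<^sub>R (\<Sum>i\<in>UNIV. x i)" and "my = (1 / n) *\<^sub>R (\<Sum>i\<in>UNIV. y i)"
  define f g where "f i = x i - mx" and "g i = y i - my" for i
  define R where "R = edge_norm p B (\<lambda>i j. x i - y j)"
  define c where "c = ?N (\<lambda>_. mx - my)"
  have f0: "(\<Sum>i\<in>UNIV. f i) = 0" and g0: "(\<Sum>i\<in>UNIV. g i) = 0"
    using n by (simp_all add: f_def g_def mx_def my_def sum_subtractf sum_constant_scaleR n_def)
  have xf: "x i - y j = (f i + - g j) + (mx - my)" for i j
    by (simp add: f_def g_def)
  \<comment> \<open>The difference of the means is the average of x i - y j with weights B i j / n.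
    Two applications of Jensen give the bound, the factor 1/n cancelling the n terms in c.\<close>
  have c: "c \<le> R"
    unfolding c_def R_def wlp_norm_def edge_norm_eq
  proof (intro powr_mono2)
    have row: "(\<Sum>j\<in>UNIV. B $ i $ j *\<^sub>R (x i - y j)) = x i - mat_act B y i" for i
      by (simp add: mat_act_def scaleR_diff_right sum_subtractf symmetric_stochasticD(3)[OF B]
          flip: scaleR_sum_left)
    have "mx - my = (\<Sum>i\<in>UNIV. (1 / n) *\<^sub>R (\<Sum>j\<in>UNIV. B $ i $ j *\<^sub>R (x i - y j)))"
      unfolding row mx_def my_def scaleR_sum_right[symmetric] sum_subtractf sum_mat_act[OF B]
      by (rule scaleR_diff_right[symmetric])
    also have "norm \<dots> powr p \<le> (\<Sum>i\<in>UNIV. 1 / n * norm (\<Sum>j\<in>UNIV. B $ i $ j *\<^sub>R (x i - y j)) powr p)"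
      using p n by (intro norm_sum_powr_le) (auto simp: n_def)
    also have "\<dots> \<le> (\<Sum>i\<in>UNIV. 1 / n * (\<Sum>j\<in>UNIV. B $ i $ j * norm (x i - y j) powr p))"
      using p n by (intro sum_mono mult_left_mono norm_sum_powr_le) (auto simp: symmetric_stochasticD[OF B])
    finally have "n * norm (mx - my) powr p
        \<le> (\<Sum>i\<in>UNIV. \<Sum>j\<in>UNIV. B $ i $ j * norm (x i - y j) powr p)"
      using n by (simp add: field_simps flip: sum_divide_distrib)
    then show "(\<Sum>i\<in>(UNIV :: 'n set). 1 * norm (mx - my) powr p)
        \<le> (\<Sum>i\<in>UNIV. \<Sum>j\<in>UNIV. B $ i $ j * norm (x i - y j) powr p)"
      by (simp add: n_def)
  qed (use p in \<open>auto intro: sum_nonneg\<close>)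
  have fg: "edge_norm p B (\<lambda>i j. f i - g j) \<le> 2 * R"
  proof -
    have "edge_norm p B (\<lambda>i j. f i - g j) = edge_norm p B (\<lambda>i j. (x i - y j) + - (mx - my))"
      by (simp add: xf)
    also have "\<dots> \<le> R + edge_norm p B (\<lambda>i j. - (mx - my))"
      unfolding R_def by (rule edge_norm_triangle[OF B p])
    also have "edge_norm p B (\<lambda>i j. - (mx - my)) = c"
      unfolding edge_norm_uminus c_def by (rule edge_norm_left[OF B])
    finally show ?thesis using c by simp
  qed
  \<comment> \<open>Each norm is bounded through the other one, so adding the estimates for (f, g)
    and (g, f) lets the terms with l be absorbed on the left.\<close>
  have half: "?N u \<le> 2 * R + l * ?N v"
    if "edge_norm p B (\<lambda>i j. u i - v j) \<le> 2 * R" "(\<Sum>i\<in>UNIV. v i) = 0" for u v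
  proof -
    have "?N u = ?N (\<lambda>i. (u i - mat_act B v i) + mat_act B v i)" by simp
    also have "\<dots> \<le> ?N (\<lambda>i. u i - mat_act B v i) + ?N (mat_act B v)"
      using p by (intro wlp_norm_triangle) auto
    finally show ?thesis
      using wlp_norm_diff_mat_act_le[OF B p, of u v] contr[OF that(2)] that(1) by linarith
  qed
  have gf: "edge_norm p B (\<lambda>i j. g i - f j) \<le> 2 * R"
    using fg edge_norm_swap[OF B, of p "\<lambda>i j. f i - g j"]
      edge_norm_uminus[of p B "\<lambda>i j. f j - g i"] by simp
  have "(1 - l) * (?N f + ?N g) \<le> 4 * R"
    using half[OF fg g0] half[OF gf f0] by (simp add: algebra_simps)
  then have Nfg: "?N f + ?N g \<le> 4 * R / (1 - l)"
    using l by (simp add: pos_le_divide_eq mult.commute)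
  have "edge_norm p U (\<lambda>i j. x i - y j) \<le> edge_norm p U (\<lambda>i j. f i + - g j) + edge_norm p U (\<lambda>i j. mx - my)"
    unfolding xf by (rule edge_norm_triangle[OF U p])
  also have "\<dots> \<le> edge_norm p U (\<lambda>i j. f i) + edge_norm p U (\<lambda>i j. - g j) + edge_norm p U (\<lambda>i j. mx - my)"
    by (intro add_right_mono edge_norm_triangle[OF U p])
  also have "\<dots> = ?N f + ?N g + c"
    unfolding edge_norm_uminus c_def edge_norm_left[OF U] edge_norm_right[OF U] by simp
  also have "\<dots> \<le> (1 + 4 / (1 - l)) * R"
    using Nfg c by (simp add: algebra_simps)
  finally have "edge_norm p U (\<lambda>i j. x i - y j) powr p \<le> ((1 + 4 / (1 - l)) * R) powr p"
    using p by (intro powr_mono2) (auto simp: edge_norm_eq)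
  also have "\<dots> = (1 + 4 / (1 - l)) powr p * R powr p"
    by (rule powr_mult)
  finally have "(\<Sum>i\<in>UNIV. \<Sum>j\<in>UNIV. 1 / n * norm (x i - y j) powr p)
      \<le> (1 + 4 / (1 - l)) powr p * (\<Sum>i\<in>UNIV. \<Sum>j\<in>UNIV. B $ i $ j * norm (x i - y j) powr p)"
    using p n by (simp add: edge_norm_eq R_def U_def powr_powr sum_nonneg symmetric_stochasticD[OF B])
  then have "(1 / n) * (\<Sum>i\<in>UNIV. \<Sum>j\<in>UNIV. 1 / n * norm (x i - y j) powr p)
      \<le> (1 / n) * ((1 + 4 / (1 - l)) powr p * (\<Sum>i\<in>UNIV. \<Sum>j\<in>UNIV. B $ i $ j * norm (x i - y j) powr p))"
    using n by (intro mult_left_mono) auto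
  then show "1 / (real CARD('n))\<^sup>2 * (\<Sum>i\<in>UNIV. \<Sum>j\<in>UNIV. norm_kernel p (x i) (y j))
      \<le> (1 + 4 / (1 - l)) powr p / real CARD('n)
        * (\<Sum>i\<in>UNIV. \<Sum>j\<in>UNIV. B $ i $ j * norm_kernel p (x i) (y j))"
    by (simp add: norm_kernel_def n_def power2_eq_square flip: sum_divide_distrib)
qed

section \<open>Constants\<close>

text \<open>Equality holds at p = 2. Beyond it, 2^(p-2) \<ge> 1 + (p - 2) ln 2 \<ge> p/2, because ln
  2 \<ge> 1/2.\<close>

lemma two_mult_le_two_powr:
  assumes "2 \<le> p" shows "2 * p \<le> 2 powr (p::real)"
proof -
  have "1 + (p - 2) * ln 2 * 1 \<le> 2 powr (p - 2)"
    using exp_ge_add_one_self[of "(p - 2) * ln 2"] by (simp add: powr_def)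
  moreover have "(p - 2) * (1 / 2) \<le> (p - 2) * ln 2"
    using assms ln2_ge_two_thirds by (intro mult_left_mono) auto
  ultimately have "p / 2 \<le> 2 powr (p - 2)" by (simp add: field_simps)
  then show ?thesis by (simp add: powr_diff)
qed

text \<open>With l = exp(-u), one has 1/(1 - l) \<le> 1 + 1/u, and 1/u = d K^p g/t. As K^p and M are
  at least 1, the base is at most (5 + 4d) K^p M \<le> (4K)^p M; the outer power p then produces the
  exponent p^2.\<close>

lemma spectral_constant_le:
  fixes p K g t :: real
  assumes p: "2 \<le> p" and K: "1 \<le> K" and g: "1 \<le> g" and t: "0 < t"
  defines "l \<equiv> exp (- 1 / ((2 powr (p - 1) - 1) * K powr p * g) * t / p)"
  shows "(1 + 4 / (1 - l)) powr p \<le> (4 * K) powr (p\<^sup>2) * max 1 ((g / t) powr p)"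
proof -
  define q :: real where "q = 2 powr p"
  define d where "d = p * (2 powr (p - 1) - 1)"
  define M where "M = max 1 (g / t)"
  have q: "2 * p \<le> q" unfolding q_def by (rule two_mult_le_two_powr[OF p])
  have d: "d = p * (q / 2 - 1)" by (simp add: d_def q_def powr_diff)
  have dpos: "0 < d" using p q by (simp add: d)
  have Kp: "1 \<le> K powr p" using K p by (simp add: ge_one_powr_ge_zero)
  define u where "u = t / (d * K powr p * g)"
  have u: "0 < u" unfolding u_def using dpos Kp g t by (intro divide_pos_pos mult_pos_pos) auto
  have l: "l = exp (- u)"
    by (simp add: l_def u_def d_def mult_ac)
  have "l \<le> 1 / (1 + u)"
    using exp_ge_add_one_self[of u] u by (simp add: l exp_minus field_simps)
  then have "u / (1 + u) \<le> 1 - l" using u by (simp add: field_simps)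
  then have "1 / (1 - l) \<le> 1 / (u / (1 + u))"
    using u by (intro divide_left_mono) (auto simp: l)
  also have "\<dots> = 1 + d * K powr p * (g / t)"
    using u g t dpos K by (simp add: u_def field_simps)
  also have "d * K powr p * (g / t) \<le> d * K powr p * M"
    using dpos by (intro mult_left_mono) (auto simp: M_def)
  finally have "1 + 4 / (1 - l) \<le> 5 * (1 * 1) + 4 * d * K powr p * M" by simp
  also have "\<dots> \<le> 5 * (K powr p * M) + 4 * d * K powr p * M"
    using Kp by (intro add_right_mono mult_left_mono mult_mono) (auto simp: M_def)
  also have "\<dots> = (5 + 4 * d) * (K powr p * M)" by (simp add: algebra_simps)
  also have "\<dots> \<le> q\<^sup>2 * (K powr p * M)"
  proof (intro mult_right_mono)
    \<comment> \<open>By 2p \<le> q, 4d = 2pq - 4p \<le> q^2 - 4p, and 5 \<le> 4p.\<close>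
    have "2 * p * q \<le> q * q" using q p by (intro mult_right_mono) auto
    then show "5 + 4 * d \<le> q\<^sup>2" using p by (simp add: d power2_eq_square algebra_simps)
  qed (simp add: M_def)
  also have "q\<^sup>2 = 4 powr p"
    by (simp add: q_def power2_eq_square flip: powr_mult)
  also have "4 powr p * (K powr p * M) = (4 * K) powr p * M"
    using K by (simp add: powr_mult)
  finally have "(1 + 4 / (1 - l)) powr p \<le> ((4 * K) powr p * M) powr p"
    using p u by (intro powr_mono2) (auto simp: l)
  also have "\<dots> = (4 * K) powr (p\<^sup>2) * M powr p"
    using K by (simp add: powr_mult powr_powr power2_eq_square M_def)
  also have "M powr p = max 1 ((g / t) powr p)"
  proof (cases "g / t \<le> 1")
    case True
    then show ?thesis using g t p by (simp add: M_def powr_le1 max_absorb1)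
  next
    case False
    then show ?thesis using p by (simp add: M_def ge_one_powr_ge_zero max_absorb2)
  qed
  finally show ?thesis .
qed

section \<open>Attainment of the infima defining the two constants\<close>

text \<open>Transfers the infimum to the reals, where closure and sequences are at hand.
  Nonemptiness excludes the value top of an empty infimum.\<close>

lemma Inf_ennreal_image:
  assumes "S \<noteq> {}" "S \<subseteq> {0..}"
  shows "Inf (ennreal ` S) = ennreal (Inf S)"
proof (rule antisym)
  have bdd: "bdd_below S" using assms by (auto intro: bdd_belowI[of _ 0])
  show "Inf (ennreal ` S) \<le> ennreal (Inf S)"
  proof (rule ennreal_le_epsilon)
    fix e :: real assume "0 < e"
    then obtain s where s: "s \<in> S" "s < Inf S + e"
      using cInf_lessD[OF assms(1), of "Inf S + e"] by auto
    have "0 \<le> Inf S" using assms by (auto intro!: cInf_greatest)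
    have "Inf (ennreal ` S) \<le> ennreal s" using s by (auto intro: Inf_lower)
    also have "\<dots> \<le> ennreal (Inf S) + ennreal e"
      using s \<open>0 \<le> Inf S\<close> \<open>0 < e\<close> by (simp flip: ennreal_plus)
    finally show "Inf (ennreal ` S) \<le> ennreal (Inf S) + ennreal e" .
  qed
  show "ennreal (Inf S) \<le> Inf (ennreal ` S)"
    using assms bdd by (auto intro!: Inf_greatest ennreal_leI cInf_lower)
qed

text \<open>For K \<ge> 1 the inequality depends continuously on K, so it survives along a sequence
  of admissible constants tending to the infimum.\<close>

lemma convexity_const_attained:
  assumes "convexity_const TYPE('a::real_normed_vector) p < top"
  obtains K where "1 \<le> K" "convexity_const TYPE('a) p = ennreal K"
    "\<And>x y :: 'a. norm x powr p + 1 / K powr p * norm y powr p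
      \<le> (norm (x + y) powr p + norm (x - y) powr p) / 2"
proof -
  define Q where "Q K \<longleftrightarrow> 1 \<le> K \<and> (\<forall>x y :: 'a. norm x powr p + 1 / K powr p * norm y powr p
      \<le> (norm (x + y) powr p + norm (x - y) powr p) / 2)" for K
  have c: "convexity_const TYPE('a) p = Inf (ennreal ` Collect Q)"
    unfolding convexity_const_def Q_def ..
  have ne: "Collect Q \<noteq> {}"
  proof
    assume "Collect Q = {}"
    with assms c show False by (simp only: image_empty Inf_empty less_irrefl)
  qed
  have eq: "Inf (ennreal ` Collect Q) = ennreal (Inf (Collect Q))"
    using ne by (intro Inf_ennreal_image) (auto simp: Q_def)
  have "Inf (Collect Q) \<in> closure (Collect Q)"
    using ne by (intro closure_contains_Inf) (auto intro!: bdd_belowI[of _ 1] simp: Q_def)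
  then obtain s where s: "\<And>n. Q (s n)" "s \<longlonglongrightarrow> Inf (Collect Q)"
    by (auto simp: closure_sequential)
  have ge: "1 \<le> Inf (Collect Q)"
    using ne by (intro cInf_greatest) (auto simp: Q_def)
  have "norm x powr p + 1 / Inf (Collect Q) powr p * norm y powr p
      \<le> (norm (x + y) powr p + norm (x - y) powr p) / 2" for x y :: 'a
  proof (rule LIMSEQ_le_const2)
    show "(\<lambda>n. norm x powr p + 1 / s n powr p * norm y powr p)
        \<longlonglongrightarrow> norm x powr p + 1 / Inf (Collect Q) powr p * norm y powr p"
      using ge s(2) by (intro tendsto_intros) auto
  qed (use s(1) in \<open>auto simp: Q_def\<close>)
  then show ?thesis using ge c eq that by metis
qed

text \<open>The inequality is linear in g and hence passes to the limit; strict positivity need not,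
  which is why only 0 \<le> g is claimed.\<close>

lemma gamma_plus_attained:
  fixes A :: "real ^ 'n ^ 'n" and K :: "'a \<Rightarrow> 'a \<Rightarrow> real"
  assumes "gamma_plus A K < top"
  obtains g where "0 \<le> g" "gamma_plus A K = ennreal g" "poincare_ineq A K g"
proof -
  define G where "G = {g. 0 < g \<and> poincare_ineq A K g}"
  have c: "gamma_plus A K = Inf (ennreal ` G)"
    by (simp add: gamma_plus_def poincare_ineq_def G_def)
  have ne: "G \<noteq> {}"
  proof
    assume "G = {}"
    with assms c show False by (simp only: image_empty Inf_empty less_irrefl)
  qed
  have eq: "Inf (ennreal ` G) = ennreal (Inf G)"
    using ne by (intro Inf_ennreal_image) (auto simp: G_def)
  have "Inf G \<in> closure G"
    using ne by (intro closure_contains_Inf) (auto intro!: bdd_belowI[of _ 0] simp: G_def)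
  then obtain s where s: "\<And>n. s n \<in> G" "s \<longlonglongrightarrow> Inf G"
    by (auto simp: closure_sequential)
  have "0 \<le> Inf G" using ne by (intro cInf_greatest) (auto simp: G_def)
  moreover have "poincare_ineq A K (Inf G)"
    unfolding poincare_ineq_def
  proof (intro allI)
    fix x y :: "'n \<Rightarrow> 'a"
    show "1 / (real CARD('n))\<^sup>2 * (\<Sum>i\<in>UNIV. \<Sum>j\<in>UNIV. K (x i) (y j))
        \<le> Inf G / real CARD('n) * (\<Sum>i\<in>UNIV. \<Sum>j\<in>UNIV. A $ i $ j * K (x i) (y j))"
    proof (rule LIMSEQ_le_const)
      show "(\<lambda>n. s n / real CARD('n) * (\<Sum>i\<in>UNIV. \<Sum>j\<in>UNIV. A $ i $ j * K (x i) (y j)))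
          \<longlonglongrightarrow> Inf G / real CARD('n) * (\<Sum>i\<in>UNIV. \<Sum>j\<in>UNIV. A $ i $ j * K (x i) (y j))"
        using s(2) by (intro tendsto_intros) auto
    qed (use s(1) in \<open>auto simp: G_def poincare_ineq_def\<close>)
  qed
  ultimately show ?thesis using c eq that by metis
qed

lemma poincare_ineq_mono:
  fixes A :: "real ^ 'n ^ 'n"
  assumes "symmetric_stochastic A" "\<And>x y. 0 \<le> K x y" "poincare_ineq A K g" "g \<le> g'"
  shows "poincare_ineq A K g'"
  unfolding poincare_ineq_def
proof (intro allI)
  fix x y :: "'n \<Rightarrow> 'a"
  have "g / real CARD('n) * (\<Sum>i\<in>UNIV. \<Sum>j\<in>UNIV. A $ i $ j * K (x i) (y j))
      \<le> g' / real CARD('n) * (\<Sum>i\<in>UNIV. \<Sum>j\<in>UNIV. A $ i $ j * K (x i) (y j))"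
    using assms by (intro mult_right_mono divide_right_mono sum_nonneg mult_nonneg_nonneg)
      (auto simp: symmetric_stochasticD)
  then show "1 / (real CARD('n))\<^sup>2 * (\<Sum>i\<in>UNIV. \<Sum>j\<in>UNIV. K (x i) (y j))
      \<le> g' / real CARD('n) * (\<Sum>i\<in>UNIV. \<Sum>j\<in>UNIV. A $ i $ j * K (x i) (y j))"
    using assms(3) unfolding poincare_ineq_def by (meson order_trans)
qed

section \<open>From the contraction of powers of \<open>A\<close> to the bound on their Poincare
  constants\<close>

theorem theorem6p7:
  fixes p :: real and t :: nat and A :: "real ^ 'n ^ 'n"
  assumes "2 \<le> p"
    and "1 \<le> t"
    and "convexity_const TYPE('a::real_normed_vector) p < top"
    and "symmetric_stochastic A"
  shows "gamma_plus (matrix_power A t) (norm_kernel p :: 'a \<Rightarrow> 'a \<Rightarrow> real)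
    \<le> ennpowr (4 * convexity_const TYPE('a) p) (p\<^sup>2)
        * max 1 (ennpowr (gamma_plus A (norm_kernel p :: 'a \<Rightarrow> 'a \<Rightarrow> real) / of_nat t) p)"
proof -
  let ?k = "norm_kernel p :: 'a \<Rightarrow> 'a \<Rightarrow> real"
  note p = assms(1) and t = assms(2) and A = assms(4)
  obtain K where K: "1 \<le> K" "convexity_const TYPE('a) p = ennreal K"
    and pc: "\<And>x y :: 'a. norm x powr p + 1 / K powr p * norm y powr p
      \<le> (norm (x + y) powr p + norm (x - y) powr p) / 2"
    using convexity_const_attained[OF assms(3)] by blast
  have CK: "ennpowr (4 * convexity_const TYPE('a) p) (p\<^sup>2) = ennreal ((4 * K) powr p\<^sup>2)"
  proof -
    have "4 * ennreal K = ennreal (4 * K)" using K by (simp add: ennreal_mult)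
    then show ?thesis using K by (simp add: ennpowr_def)
  qed
  show ?thesis
  proof (cases "gamma_plus A ?k < top")
    case False
    then have "gamma_plus A ?k = top" by (metis less_top)
    then have "gamma_plus A ?k / of_nat t = top"
      by (simp add: ennreal_top_divide flip: ennreal_of_nat_eq_real_of_nat)
    then have "ennpowr (gamma_plus A ?k / of_nat t) p = top"
      by (simp add: ennpowr_def)
    \<comment> \<open>In \<open>ennreal\<close>, 0 * top = 0; the first factor is nonzero because K
      \<ge> 1, so the right-hand side is top.\<close>
    then show ?thesis
      using K(1) by (simp add: CK ennreal_mult_top max_def)
  next
    case True
    then obtain g0 where g0: "0 \<le> g0" "gamma_plus A ?k = ennreal g0" "poincare_ineq A ?k g0"
      using gamma_plus_attained by blast
    \<comment> \<open>\<open>g0 = 0\<close> is possible (trivial space). Enlarging it to \<open>1 \<le> t\<close> does not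
      change the maximum on the right-hand side.\<close>
    define g where "g = max 1 g0"
    define l where "l = exp (- 1 / ((2 powr (p - 1) - 1) * K powr p * g) * real t / p)"
    have "poincare_ineq A ?k g"
      using poincare_ineq_mono[OF A _ g0(3)] by (simp add: g_def norm_kernel_def)
    then have "(\<Sum>i\<in>UNIV. norm (mat_act A f i) powr p)
        \<le> exp (- 1 / ((2 powr (p - 1) - 1) * K powr p * g)) * (\<Sum>i\<in>UNIV. norm (f i) powr p)"
      if "(\<Sum>i\<in>UNIV. f i) = 0" for f :: "'n \<Rightarrow> 'a"
      using p K pc that by (intro mat_act_contraction A) (auto simp: g_def)
    then have "wlp_norm p (\<lambda>_. 1) UNIV (mat_act (matrix_power A t) f) \<le> l * wlp_norm p (\<lambda>_. 1) UNIV f"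
      if "(\<Sum>i\<in>UNIV. f i) = 0" for f :: "'n \<Rightarrow> 'a"
      unfolding l_def using p that by (intro mat_act_power_contraction A) auto
    \<comment> \<open>This uses t \<ge> 1: for t = 0 the factor l would equal 1.\<close>
    moreover have "l < 1"
    proof -
      have "2 powr 0 < (2 :: real) powr (p - 1)" using p by (intro powr_less_mono) auto
      then show ?thesis using K t p by (simp add: l_def g_def)
    qed
    ultimately have "poincare_ineq (matrix_power A t) ?k ((1 + 4 / (1 - l)) powr p)"
      using p by (intro poincare_ineq_of_contraction symmetric_stochastic_matrix_power A)
        (auto simp: l_def)
    moreover have "0 < 1 + 4 / (1 - l)"
      using \<open>l < 1\<close> by (simp add: add_pos_pos)
    ultimately have "gamma_plus (matrix_power A t) ?k \<le> ennreal ((1 + 4 / (1 - l)) powr p)"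
      unfolding gamma_plus_def by (intro Inf_lower imageI) (auto simp: poincare_ineq_def)
    also have "\<dots> \<le> ennreal ((4 * K) powr p\<^sup>2 * max 1 ((g / real t) powr p))"
      unfolding l_def using p K t by (intro ennreal_leI spectral_constant_le) (auto simp: g_def)
    also have "max 1 ((g / real t) powr p) = max 1 ((g0 / real t) powr p)"
    proof (cases "g0 \<le> 1")
      case True
      then have "(1 / real t) powr p \<le> 1" "(g0 / real t) powr p \<le> 1"
        using t p g0 by (auto intro!: powr_le1)
      then show ?thesis using True by (simp add: g_def max_absorb1)
    qed (simp add: g_def)
    also have "ennreal ((4 * K) powr p\<^sup>2 * max 1 ((g0 / real t) powr p))
        = ennpowr (4 * convexity_const TYPE('a) p) (p\<^sup>2) * max 1 (ennpowr (gamma_plus A ?k / of_nat t) p)"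
    proof -
      have "ennreal g0 / of_nat t = ennreal (g0 / real t)"
        using t g0 by (simp add: ennreal_of_nat_eq_real_of_nat divide_ennreal)
      then have "ennpowr (gamma_plus A ?k / of_nat t) p = ennreal ((g0 / real t) powr p)"
        using g0 by (simp add: ennpowr_def)
      then show ?thesis
        unfolding CK by (simp add: ennreal_mult max_def flip: ennreal_1)
    qed
    finally show ?thesis .
  qed
qed

end
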